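(* The following holds for every $p,q\in\mathbb{N}$ (positive integers): (1) Let $G$ be a graph that is cospectral (with respect to the adjacency matrix) with the complete bipartite graph $K_{p,q}$. Then, up to isomorphism, $G$ is a disjoint union of $K_{a,b}$ and $H$, where $H$ is an empty graph (a graph with no edges, possibly with no vertices) and $a,b\in\mathbb{N}$ satisfy $\sqrt{ab}=\sqrt{pq}$. (2) The complete bipartite graph $K_{p,q}$ is determined by its adjacency spectrum if and only if $\{p,q\}$ is an AM-minimizer.
   Context: All graphs are finite, simple and undirected. Two graphs are cospectral if their adjacency matrices have the same multiset of eigenvalues; a graph is determined by its adjacency spectrum (DS) if every graph cospectral with it is isomorphic to it. For $p,q\in\mathbb{N}$, the two-element multiset $\{p,q\}$ is an AM-minimizer if $\frac{p+q}{2} = \min\{\frac{a+b}{2} : a,b\in\mathbb{N},\ ab=pq\}$. *)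

theory Defs
  imports
    "HOL-Computational_Algebra.Fundamental_Theorem_Algebra"
    "Jordan_Normal_Form.Char_Poly"
    "Graph_Theory.Graph_Theory"
begin

text \<open>
  A finite simple undirected graph is a \<^const>\<open>pair_graph\<close>: finitely many vertices, and a
  symmetric irreflexive set of arcs, so that an edge between \<open>u\<close> and \<open>v\<close> is represented
  by the two arcs \<open>(u, v)\<close> and \<open>(v, u)\<close>. Graphs without vertices are allowed.
  Graph isomorphism is \<^const>\<open>digraph_iso\<close> on the images under \<^const>\<open>with_proj\<close>.
\<close>

section \<open>Graph constructions\<close>

definition complete_bipartite :: "nat \<Rightarrow> nat \<Rightarrow> (nat + nat) pair_pre_digraph" where
  "complete_bipartite p q =
    \<lparr> pverts = Inl ` {..<p} \<union> Inr ` {..<q},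
      parcs = (Inl ` {..<p}) \<times> (Inr ` {..<q}) \<union> (Inr ` {..<q}) \<times> (Inl ` {..<p}) \<rparr>"

definition disjoint_union ::
    "'a pair_pre_digraph \<Rightarrow> 'b pair_pre_digraph \<Rightarrow> ('a + 'b) pair_pre_digraph" where
  "disjoint_union G H =
    \<lparr> pverts = Inl ` pverts G \<union> Inr ` pverts H,
      parcs = map_prod Inl Inl ` parcs G \<union> map_prod Inr Inr ` parcs H \<rparr>"

definition empty_graph :: "'a pair_pre_digraph \<Rightarrow> bool" where
  "empty_graph H \<longleftrightarrow> pair_graph H \<and> parcs H = {}"

lemma complete_bipartite_digraph_complete_bipartite:
  "complete_bipartite_digraph p q (with_proj (complete_bipartite p q))"
proof -
  let ?U = "Inl ` {..<p} :: (nat + nat) set" and ?V = "Inr ` {..<q} :: (nat + nat) set"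
  have "pverts (complete_bipartite p q) = ?U \<union> ?V \<and> ?U \<inter> ?V = {} \<and> card ?U = p \<and> card ?V = q
      \<and> parcs (complete_bipartite p q) = ?U \<times> ?V \<union> ?V \<times> ?U"
    by (auto simp: complete_bipartite_def card_image)
  moreover have "finite (pverts (complete_bipartite p q))"
    by (simp add: complete_bipartite_def)
  ultimately show ?thesis
    unfolding complete_bipartite_digraph_pair_def by (intro conjI exI[of _ ?U] exI[of _ ?V]) simp_all
qed

lemma pair_graph_complete_bipartite: "pair_graph (complete_bipartite p q)"
  by (rule pair_graphI_complete_bipartite[OF complete_bipartite_digraph_complete_bipartite])

section \<open>Adjacency spectrum\<close>

definition adjacency_matrix :: "'a pair_pre_digraph \<Rightarrow> 'a list \<Rightarrow> complex mat" where
  "adjacency_matrix G vs =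
    mat (length vs) (length vs) (\<lambda>(i, j). if (vs ! i, vs ! j) \<in> parcs G then 1 else 0)"

text \<open>
  The eigenvalues are counted with algebraic multiplicity, as roots of the characteristic
  polynomial over the complex numbers; since the matrix is real symmetric they are all real and
  the algebraic and geometric multiplicities agree. The choice of the enumeration of the vertices
  is irrelevant, see \<open>adjacency_spectrum_eq\<close> below.
\<close>

definition adjacency_spectrum :: "'a pair_pre_digraph \<Rightarrow> complex multiset" where
  "adjacency_spectrum G =
    proots (char_poly (adjacency_matrix G (SOME vs. distinct vs \<and> set vs = pverts G)))"

definition cospectral :: "'a pair_pre_digraph \<Rightarrow> 'b pair_pre_digraph \<Rightarrow> bool" where
  "cospectral G H \<longleftrightarrow> adjacency_spectrum G = adjacency_spectrum H"

text \<open>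
  Quantification over the graphs on natural numbers suffices since graphs are finite;
  see \<open>determined_by_spectrumD\<close> below for the consequence at an arbitrary vertex type.
\<close>

definition determined_by_spectrum :: "'a pair_pre_digraph \<Rightarrow> bool" where
  "determined_by_spectrum G \<longleftrightarrow>
    (\<forall>H :: nat pair_pre_digraph.
      pair_graph H \<and> cospectral H G \<longrightarrow> digraph_iso (with_proj H) (with_proj G))"

section \<open>AM-minimizers\<close>

definition AM_minimizer :: "nat \<Rightarrow> nat \<Rightarrow> bool" where
  "AM_minimizer p q \<longleftrightarrow>
    (real p + real q) / 2 =
      Min {(real a + real b) / 2 | a b :: nat. a > 0 \<and> b > 0 \<and> a * b = p * q}"

text \<open>For positive \<open>p\<close> and \<open>q\<close> the minimum is taken over a finite nonempty set.\<close>

lemma AM_minimizer_set_finite: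
  assumes "p > 0" "q > 0"
  shows "finite {(real a + real b) / 2 | a b :: nat. a > 0 \<and> b > 0 \<and> a * b = p * q}"
proof (rule finite_subset)
  show "{(real a + real b) / 2 | a b :: nat. a > 0 \<and> b > 0 \<and> a * b = p * q}
    \<subseteq> (\<lambda>(a, b). (real a + real b) / 2) ` ({..p * q} \<times> {..p * q})"
  proof safe
    fix a b :: nat assume "a > 0" "b > 0" "a * b = p * q"
    then have "(a, b) \<in> {..p * q} \<times> {..p * q}"
      by (metis (no_types) SigmaI atMost_iff dvd_imp_le dvd_triv_left dvd_triv_right
          nat_0_less_mult_iff)
    then show "(real a + real b) / 2
      \<in> (\<lambda>(a, b). (real a + real b) / 2) ` ({..p * q} \<times> {..p * q})"
      by (intro image_eqI[of _ _ "(a, b)"]) auto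
  qed
qed simp

section \<open>Well-definedness\<close>

lemma sum_nth_distinct:
  fixes g :: "'a \<Rightarrow> 'b :: comm_monoid_add"
  assumes "distinct vs"
  shows "(\<Sum>k = 0..<length vs. g (vs ! k)) = sum g (set vs)"
proof -
  have "bij_betw ((!) vs) {0..<length vs} (set vs)"
    using bij_betw_nth[OF assms] by (simp add: lessThan_atLeast0)
  then show ?thesis by (rule sum.reindex_bij_betw)
qed

lemma char_poly_adjacency_matrix_cong:
  assumes "distinct vs" "distinct ws" "set vs = set ws"
  shows "char_poly (adjacency_matrix G vs) = char_poly (adjacency_matrix G ws)"
proof (rule char_poly_similar)
  let ?n = "length vs"
  have n: "length ws = ?n" using assms by (metis distinct_card)
  let ?P = "mat ?n ?n (\<lambda>(i, j). of_bool (vs ! i = ws ! j)) :: complex mat"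
  let ?Q = "mat ?n ?n (\<lambda>(i, j). of_bool (ws ! i = vs ! j)) :: complex mat"
  have mv: "vs ! i \<in> set vs" "ws ! i \<in> set vs" if "i < ?n" for i
    using that n assms(3) by (auto intro: nth_mem)
  have sv: "(\<Sum>k = 0..<?n. g (vs ! k)) = sum g (set vs)" for g :: "'a \<Rightarrow> complex"
    by (rule sum_nth_distinct[OF assms(1)])
  have sw: "(\<Sum>k = 0..<?n. g (ws ! k)) = sum g (set vs)" for g :: "'a \<Rightarrow> complex"
    using sum_nth_distinct[OF assms(2), of g] by (simp add: n assms(3))
  have dv: "(\<Sum>x\<in>set vs. of_bool (u = x) * g x) = g u"
    if "u \<in> set vs" for u and g :: "'a \<Rightarrow> complex"
    using that by (simp add: of_bool_def if_distrib[of "\<lambda>c. c * _"] sum.delta' cong: if_cong)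
  have dv': "(\<Sum>x\<in>set vs. g x * of_bool (x = u)) = g u"
    if "u \<in> set vs" for u and g :: "'a \<Rightarrow> complex"
    using that by (simp add: of_bool_def if_distrib[of "\<lambda>c. _ * c"] sum.delta cong: if_cong)
  have PQ: "?P * ?Q = 1\<^sub>m ?n"
  proof (rule eq_matI)
    fix i j assume "i < dim_row (1\<^sub>m ?n)" "j < dim_col (1\<^sub>m ?n)"
    then have ij: "i < ?n" "j < ?n" by auto
    have "(?P * ?Q) $$ (i, j)
        = (\<Sum>k = 0..<?n. of_bool (vs ! i = ws ! k) * of_bool (ws ! k = vs ! j))"
      using ij by (simp add: scalar_prod_def)
    also have "\<dots> = of_bool (vs ! i = vs ! j)"
      using sw[of "\<lambda>x. of_bool (vs ! i = x) * of_bool (x = vs ! j)"]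
        dv[OF mv(1)[OF ij(1)], of "\<lambda>x. of_bool (x = vs ! j)"] by (simp only:)
    finally show "(?P * ?Q) $$ (i, j) = 1\<^sub>m ?n $$ (i, j)"
      using ij assms(1) by (simp add: nth_eq_iff_index_eq)
  qed auto
  have QP: "?Q * ?P = 1\<^sub>m ?n"
  proof (rule eq_matI)
    fix i j assume "i < dim_row (1\<^sub>m ?n)" "j < dim_col (1\<^sub>m ?n)"
    then have ij: "i < ?n" "j < ?n" by auto
    have "(?Q * ?P) $$ (i, j)
        = (\<Sum>k = 0..<?n. of_bool (ws ! i = vs ! k) * of_bool (vs ! k = ws ! j))"
      using ij by (simp add: scalar_prod_def)
    also have "\<dots> = of_bool (ws ! i = ws ! j)"
      using sv[of "\<lambda>x. of_bool (ws ! i = x) * of_bool (x = ws ! j)"]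
        dv[OF mv(2)[OF ij(1)], of "\<lambda>x. of_bool (x = ws ! j)"] by (simp only:)
    finally show "(?Q * ?P) $$ (i, j) = 1\<^sub>m ?n $$ (i, j)"
      using ij assms(2) n by (simp add: nth_eq_iff_index_eq)
  qed auto
  let ?a = "\<lambda>u v. if (u, v) \<in> parcs G then 1 else 0 :: complex"
  have "adjacency_matrix G vs = ?P * adjacency_matrix G ws * ?Q"
  proof (rule eq_matI)
    fix i j assume "i < dim_row (?P * adjacency_matrix G ws * ?Q)"
      "j < dim_col (?P * adjacency_matrix G ws * ?Q)"
    then have ij: "i < ?n" "j < ?n" by auto
    have PA: "(?P * adjacency_matrix G ws) $$ (i, k) = ?a (vs ! i) (ws ! k)" if "k < ?n" for k
    proof -
      have "(?P * adjacency_matrix G ws) $$ (i, k)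
          = (\<Sum>l = 0..<?n. of_bool (vs ! i = ws ! l) * ?a (ws ! l) (ws ! k))"
        using ij that n by (simp add: scalar_prod_def adjacency_matrix_def)
      also have "\<dots> = ?a (vs ! i) (ws ! k)"
        using sw[of "\<lambda>x. of_bool (vs ! i = x) * ?a x (ws ! k)"]
          dv[OF mv(1)[OF ij(1)], of "\<lambda>x. ?a x (ws ! k)"] by (simp only:)
      finally show ?thesis .
    qed
    have "(?P * adjacency_matrix G ws * ?Q) $$ (i, j)
        = (\<Sum>k = 0..<?n. (?P * adjacency_matrix G ws) $$ (i, k) * of_bool (ws ! k = vs ! j))"
      using ij n by (simp add: scalar_prod_def adjacency_matrix_def)
    also have "\<dots> = (\<Sum>k = 0..<?n. ?a (vs ! i) (ws ! k) * of_bool (ws ! k = vs ! j))"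
      by (rule sum.cong[OF refl]) (subst PA, auto)
    also have "\<dots> = ?a (vs ! i) (vs ! j)"
      using sw[of "\<lambda>x. ?a (vs ! i) x * of_bool (x = vs ! j)"]
        dv'[OF mv(1)[OF ij(2)], of "\<lambda>x. ?a (vs ! i) x"] by (simp only:)
    finally show "adjacency_matrix G vs $$ (i, j) = (?P * adjacency_matrix G ws * ?Q) $$ (i, j)"
      using ij by (simp add: adjacency_matrix_def)
  qed (auto simp: adjacency_matrix_def n)
  then show "similar_mat (adjacency_matrix G vs) (adjacency_matrix G ws)"
    by (intro similar_matI[OF _ PQ QP]) (auto simp: adjacency_matrix_def n)
qed

lemma adjacency_spectrum_eq:
  assumes "distinct vs" "set vs = pverts G"
  shows "adjacency_spectrum G = proots (char_poly (adjacency_matrix G vs))"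
proof -
  let ?ws = "SOME vs. distinct vs \<and> set vs = pverts G"
  have "distinct ?ws \<and> set ?ws = pverts G"
    by (rule someI[of "\<lambda>vs. distinct vs \<and> set vs = pverts G" vs]) (use assms in simp)
  then show ?thesis
    unfolding adjacency_spectrum_def
    using char_poly_adjacency_matrix_cong[of ?ws vs G] assms by simp
qed

lemma adjacency_spectrum_image:
  assumes G: "pair_graph G" and inj: "inj_on f (pverts G)"
    and H: "pverts H = f ` pverts G" "parcs H = map_prod f f ` parcs G"
  shows "adjacency_spectrum H = adjacency_spectrum G"
proof -
  interpret pair_graph G by (rule G)
  obtain vs where vs: "distinct vs" "set vs = pverts G"
    using finite_distinct_list[OF pair_finite_verts] by metis
  have arcs: "(f u, f v) \<in> parcs H \<longleftrightarrow> (u, v) \<in> parcs G"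
    if uv: "u \<in> pverts G" "v \<in> pverts G" for u v
  proof
    assume "(f u, f v) \<in> parcs H"
    then obtain x y where xy: "(x, y) \<in> parcs G" "f u = f x" "f v = f y"
      unfolding H by auto
    then have "u = x" "v = y"
      using inj uv wellformed'[OF xy(1)] by (auto dest: inj_onD)
    then show "(u, v) \<in> parcs G" using xy by simp
  qed (auto simp: H)
  have "adjacency_matrix H (map f vs) = adjacency_matrix G vs"
    unfolding adjacency_matrix_def
  proof (rule eq_matI, goal_cases)
    case (1 i j)
    then have "vs ! i \<in> pverts G" "vs ! j \<in> pverts G"
      by (simp_all add: vs(2)[symmetric])
    then show ?case using 1 arcs by simp
  qed simp_all
  moreover have "distinct (map f vs)" "set (map f vs) = pverts H"
    using vs inj by (auto simp: distinct_map H)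
  ultimately show ?thesis
    using adjacency_spectrum_eq[of "map f vs" H] adjacency_spectrum_eq[OF vs] by simp
qed

lemma digraph_iso_image:
  assumes G: "pair_graph G" and inj: "inj_on f (pverts G)"
    and H: "pverts H = f ` pverts G" "parcs H = map_prod f f ` parcs G"
  shows "digraph_iso (with_proj G) (with_proj H)"
proof -
  interpret pair_graph G by (rule G)
  let ?h = "\<lparr> iso_verts = f, iso_arcs = map_prod f f, iso_head = snd, iso_tail = fst \<rparr>"
  have "inj_on (map_prod f f) (parcs G)"
  proof (rule inj_onI)
    fix d e assume "d \<in> parcs G" "e \<in> parcs G" "map_prod f f d = map_prod f f e"
    then show "d = e"
      using inj_onD[OF inj, of "fst d" "fst e"] inj_onD[OF inj, of "snd d" "snd e"]
        arc_fst_in_verts arc_snd_in_verts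
      by (simp add: prod_eq_iff)
  qed
  then have "pre_digraph.digraph_isomorphism (with_proj G) ?h"
    using inj wf_digraph_axioms by (simp add: pre_digraph.digraph_isomorphism_def)
  moreover have "with_proj H = app_iso ?h (with_proj G)"
    by (simp add: app_iso_def with_proj_def H)
  ultimately show ?thesis unfolding digraph_iso_def by blast
qed

lemma cospectral_if_digraph_iso:
  assumes G: "pair_graph G" and iso: "digraph_iso (with_proj G) (with_proj H)"
  shows "cospectral G H"
proof -
  obtain h where h: "pre_digraph.digraph_isomorphism (with_proj G) h"
      "with_proj H = app_iso h (with_proj G)"
    using iso unfolding digraph_iso_def by blast
  let ?f = "iso_verts h"
  have V: "pverts H = ?f ` pverts G" and A: "parcs H = iso_arcs h ` parcs G"
    and th: "iso_tail h = fst" "iso_head h = snd"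
    using h(2) by (simp_all add: app_iso_def with_proj_def)
  have "iso_arcs h e = map_prod ?f ?f e" if "e \<in> parcs G" for e
    using h(1) that unfolding pre_digraph.digraph_isomorphism_def
    by (auto simp: th prod_eq_iff)
  then have "parcs H = map_prod ?f ?f ` parcs G" unfolding A by (rule image_cong[OF refl])
  moreover have "inj_on ?f (pverts G)"
    using h(1) by (simp add: pre_digraph.digraph_isomorphism_def)
  ultimately show ?thesis
    using adjacency_spectrum_image[OF G _ V] unfolding cospectral_def by simp
qed

lemma determined_by_spectrumD:
  assumes ds: "determined_by_spectrum G" and H: "pair_graph H" and co: "cospectral H G"
  shows "digraph_iso (with_proj H) (with_proj G)"
proof -
  interpret H: pair_graph H by (rule H)
  obtain f :: "'b \<Rightarrow> nat" where f: "inj_on f (pverts H)"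
    using finite_imp_inj_to_nat_seg[OF H.pair_finite_verts] by metis
  define H' where "H' = \<lparr> pverts = f ` pverts H, parcs = map_prod f f ` parcs H \<rparr>"
  have iso: "digraph_iso (with_proj H) (with_proj H')"
    by (rule digraph_iso_image[OF H f]) (simp_all add: H'_def)
  have "adjacency_spectrum H' = adjacency_spectrum H"
    by (rule adjacency_spectrum_image[OF H f]) (simp_all add: H'_def)
  with co have "cospectral H' G" by (simp add: cospectral_def)
  moreover have "pair_graph H'"
  proof
    show "symmetric (with_proj H')"
      using H.pair_sym_arcs by (fastforce simp: symmetric_def H'_def sym_def)
  next
    fix e assume "e \<in> parcs H'"
    then obtain u v where uv: "(u, v) \<in> parcs H" "e = (f u, f v)" by (auto simp: H'_def)
    then show "fst e \<in> pverts H'" "snd e \<in> pverts H'"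
      using H.wellformed' by (auto simp: H'_def)
    show "fst e \<noteq> snd e"
      using uv H.pair_no_loops[OF uv(1)] H.wellformed'[OF uv(1)] f by (auto dest: inj_onD)
  qed (use H.pair_finite_verts H.pair_finite_arcs in \<open>auto simp: H'_def\<close>)
  ultimately have "digraph_iso (with_proj H') (with_proj G)"
    using ds by (simp add: determined_by_spectrum_def)
  with iso show ?thesis by (rule digraph_iso_trans)
qed

end

(*
  The power sums of the eigenvalues are the numbers of closed walks, and they determine the
  spectrum, so two graphs are cospectral iff they have equally many closed walks of every length.
  In a complete bipartite graph with c edges, possibly with isolated vertices added, A^3 = c A.
  Hence its closed walk counts, and so its spectrum, depend only on c and the number of vertices.
  Conversely, let G have the same closed walk counts, and put N = A^3 - c A. Then tr N^2 vanishes,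
  and since A is real symmetric N = 0. So the ends of every walk of length 3 are adjacent, and an
  edge uv lies in a complete bipartite subgraph on N(u) and N(v), which has
  |N(u)| |N(v)| = (A^3)_uv = c edges. As G has only c edges, there are no others.
*)

theory Submission
  imports Defs "Jordan_Normal_Form.Schur_Decomposition"
begin

section \<open>Power sums of eigenvalues\<close>

text \<open>Shows that the sum of a fixed polynomial over a multiset depends on the multiset only
  through its power sums.\<close>

lemma sum_mset_poly:
  fixes M :: "'a :: comm_ring_1 multiset"
  shows "(\<Sum>e\<in>#M. poly f e) = (\<Sum>i\<le>degree f. coeff f i * (\<Sum>e\<in>#M. e ^ i))"
  by (induction M) (simp_all add: poly_altdef sum.distrib distrib_left)

lemma sum_mset_indicator:
  fixes g :: "'a \<Rightarrow> 'b :: comm_semiring_1"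
  assumes "\<And>e. e \<in># M \<Longrightarrow> e \<noteq> x \<Longrightarrow> g e = 0"
  shows "(\<Sum>e\<in>#M. g e) = of_nat (count M x) * g x"
  using assms
proof (induction M)
  case (add y M)
  then show ?case by (cases "y = x") (simp_all add: distrib_right)
qed simp

text \<open>
  Testing against the polynomial that vanishes exactly at all elements other than \<open>x\<close>
  isolates the multiplicity of \<open>x\<close>.
\<close>

lemma mset_eqI_power_sums:
  fixes M N :: "'a :: field_char_0 multiset"
  assumes "\<And>k. (\<Sum>e\<in>#M. e ^ k) = (\<Sum>e\<in>#N. e ^ k)"
  shows "M = N"
proof (rule multiset_eqI)
  fix x
  define f where "f = (\<Prod>s\<in>(set_mset M \<union> set_mset N) - {x}. [:- s, 1:])"
  have f: "poly f e = 0 \<longleftrightarrow> e \<in> (set_mset M \<union> set_mset N) - {x}" for e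
    by (auto simp: f_def poly_prod)
  have "of_nat (count M x) * poly f x = (\<Sum>e\<in>#M. poly f e)"
    by (rule sum_mset_indicator[symmetric]) (use f in auto)
  also have "\<dots> = (\<Sum>e\<in>#N. poly f e)"
    by (simp only: sum_mset_poly assms)
  also have "\<dots> = of_nat (count N x) * poly f x"
    by (rule sum_mset_indicator) (use f in auto)
  \<comment> \<open>Since \<open>poly f x\<close> is nonzero it cancels, and characteristic 0 makes
    \<open>of_nat\<close> injective.\<close>
  finally show "count M x = count N x"
    using f[of x] by simp
qed

section \<open>Traces of matrix powers\<close>

lemma trace_mult_commute:
  fixes A B :: "'a :: comm_ring_1 mat"
  assumes "A \<in> carrier_mat n n" "B \<in> carrier_mat n n"
  shows "(\<Sum>i<n. (A * B) $$ (i, i)) = (\<Sum>i<n. (B * A) $$ (i, i))"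
proof -
  have "(\<Sum>i<n. (A * B) $$ (i, i)) = (\<Sum>i<n. \<Sum>k<n. A $$ (i, k) * B $$ (k, i))"
    using assms by (auto simp: scalar_prod_def lessThan_atLeast0)
  also have "\<dots> = (\<Sum>k<n. \<Sum>i<n. B $$ (k, i) * A $$ (i, k))"
    by (subst sum.swap) (simp add: mult.commute)
  also have "\<dots> = (\<Sum>i<n. (B * A) $$ (i, i))"
    using assms by (auto simp: scalar_prod_def lessThan_atLeast0)
  finally show ?thesis .
qed

text \<open>By cyclicity of the trace, \<open>Q\<close> moves to the front, where it cancels against
  \<open>P\<close>.\<close>

lemma trace_similar:
  fixes A B :: "'a :: comm_ring_1 mat"
  assumes A: "A \<in> carrier_mat n n" and wit: "similar_mat_wit A B P Q"
  shows "(\<Sum>i<n. A $$ (i, i)) = (\<Sum>i<n. B $$ (i, i))"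
proof -
  have c: "B \<in> carrier_mat n n" "P \<in> carrier_mat n n" "Q \<in> carrier_mat n n"
    and QP: "Q * P = 1\<^sub>m n" and AB: "A = P * B * Q"
    using similar_mat_witD2[OF A wit] by auto
  have "(\<Sum>i<n. A $$ (i, i)) = (\<Sum>i<n. (Q * (P * B)) $$ (i, i))"
    unfolding AB by (rule trace_mult_commute) (use c in auto)
  also have "Q * (P * B) = B"
    using c QP by (simp flip: assoc_mult_mat)
  finally show ?thesis .
qed

text \<open>In entry (i, j) of the product of A^k and \<open>A\<close>, the terms with l < i vanish
  by induction, and those with l > i because \<open>A\<close> is triangular and j \<le> i < l. Only
  l = i survives.\<close>

lemma upper_triangular_pow:
  fixes A :: "'a :: comm_ring_1 mat"
  assumes A: "A \<in> carrier_mat n n" and ut: "upper_triangular A"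
  shows "i < n \<Longrightarrow> j \<le> i \<Longrightarrow> (A ^\<^sub>m k) $$ (i, j) = (if i = j then A $$ (i, i) ^ k else 0)"
proof (induction k arbitrary: j)
  case 0
  then show ?case using A by auto
next
  case (Suc k)
  have Ak: "A ^\<^sub>m k \<in> carrier_mat n n" using A by simp
  have "(A ^\<^sub>m Suc k) $$ (i, j) = (\<Sum>l<n. (A ^\<^sub>m k) $$ (i, l) * A $$ (l, j))"
    using A Ak Suc.prems by (auto simp: scalar_prod_def lessThan_atLeast0)
  also have "\<dots> = (\<Sum>l<n. if l = i then (A ^\<^sub>m k) $$ (i, i) * A $$ (i, j) else 0)"
  proof (rule sum.cong[OF refl])
    fix l assume l: "l \<in> {..<n}"
    show "(A ^\<^sub>m k) $$ (i, l) * A $$ (l, j) =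
        (if l = i then (A ^\<^sub>m k) $$ (i, i) * A $$ (i, j) else 0)"
    proof (cases "l < i")
      case True
      then show ?thesis using Suc.IH[of l] Suc.prems by simp
    next
      case False
      then have "l \<noteq> i \<Longrightarrow> A $$ (l, j) = 0"
        using upper_triangularD[OF ut, of j l] A l Suc.prems by auto
      then show ?thesis by simp
    qed
  qed
  also have "\<dots> = A $$ (i, i) ^ k * A $$ (i, j)"
    using Suc.IH[of i] Suc.prems by simp
  finally show ?case
    using upper_triangularD[OF ut, of j i] A Suc.prems by auto
qed

text \<open>The Schur decomposition makes \<open>A\<close> similar to an upper triangular
  \<open>B\<close> whose diagonal lists the roots of the characteristic polynomial with
  multiplicity. Powers stay similar, so the trace of A^k can be read off the diagonal of
  B^k.\<close>

lemma power_sum_proots_char_poly: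
  fixes A :: "complex mat"
  assumes A: "A \<in> carrier_mat n n"
  shows "(\<Sum>e\<in>#proots (char_poly A). e ^ k) = (\<Sum>i<n. (A ^\<^sub>m k) $$ (i, i))"
proof -
  obtain es where es: "char_poly A = (\<Prod>e\<leftarrow>es. [:- e, 1:])"
    using char_poly_factorized[OF A] by blast
  obtain B P Q where "schur_decomposition A es = (B, P, Q)"
    by (cases "schur_decomposition A es") auto
  from schur_decomposition[OF A es this]
  have wit: "similar_mat_wit A B P Q" and ut: "upper_triangular B" and diag: "diag_mat B = es"
    by auto
  have B: "B \<in> carrier_mat n n" using similar_mat_witD2[OF A wit] by auto
  have "(\<Sum>i<n. (A ^\<^sub>m k) $$ (i, i)) = (\<Sum>i<n. (B ^\<^sub>m k) $$ (i, i))"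
    by (rule trace_similar[OF _ similar_mat_wit_pow[OF wit]]) (use A in simp)
  also have "\<dots> = (\<Sum>i<n. B $$ (i, i) ^ k)"
    using upper_triangular_pow[OF B ut] by simp
  also have "\<dots> = (\<Sum>e\<leftarrow>es. e ^ k)"
    using B by (simp add: diag[symmetric] diag_mat_def comp_def interv_sum_list_conv_sum_set_nat
        lessThan_atLeast0)
  also have "\<dots> = (\<Sum>e\<in>#mset es. e ^ k)"
    by (simp flip: sum_mset_sum_list)
  also have "mset es = proots (char_poly A)"
  proof -
    have "proots (\<Prod>e\<leftarrow>es. [:- e, 1:]) = mset es"
    proof (induction es)
      case (Cons e es)
      have "(\<Prod>e\<leftarrow>es. [:- e, 1:]) \<noteq> 0" by (auto simp: prod_list_zero_iff)
      then have "proots ([:- e, 1:] * (\<Prod>e\<leftarrow>es. [:- e, 1:])) = {#e#} + mset es"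
        by (subst proots_mult) (use Cons in auto)
      then show ?case by simp
    qed simp
    then show ?thesis using es by simp
  qed
  finally show ?thesis by simp
qed

section \<open>Walks\<close>

text \<open>On vertices, these are the entries of the powers of the adjacency matrix. Indexing by
  vertices avoids enumerations, and values in \<open>nat\<close> allow counting arguments.\<close>

primrec walks :: "'a pair_pre_digraph \<Rightarrow> nat \<Rightarrow> 'a \<Rightarrow> 'a \<Rightarrow> nat" where
  "walks G 0 u v = of_bool (u = v)"
| "walks G (Suc k) u v = (\<Sum>w\<in>pverts G. walks G k u w * of_bool ((w, v) \<in> parcs G))"

definition closed_walks :: "'a pair_pre_digraph \<Rightarrow> nat \<Rightarrow> nat" where
  "closed_walks G k = (\<Sum>v\<in>pverts G. walks G k v v)"

lemma adjacency_matrix_pow: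
  assumes "distinct vs" "set vs = pverts G" "i < length vs" "j < length vs"
  shows "(adjacency_matrix G vs ^\<^sub>m k) $$ (i, j) = of_nat (walks G k (vs ! i) (vs ! j))"
  using assms(4)
proof (induction k arbitrary: j)
  case 0
  then show ?case
    using assms by (simp add: adjacency_matrix_def nth_eq_iff_index_eq)
next
  case (Suc k)
  let ?A = "adjacency_matrix G vs" and ?n = "length vs"
  have A: "?A \<in> carrier_mat ?n ?n" "?A ^\<^sub>m k \<in> carrier_mat ?n ?n"
    by (auto simp: adjacency_matrix_def)
  have "(?A ^\<^sub>m Suc k) $$ (i, j) = (\<Sum>l = 0..<?n. (?A ^\<^sub>m k) $$ (i, l) * ?A $$ (l, j))"
    using A assms(3) Suc.prems by (simp add: scalar_prod_def)
  also have "\<dots> = (\<Sum>l = 0..<?n.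
      of_nat (walks G k (vs ! i) (vs ! l) * of_bool ((vs ! l, vs ! j) \<in> parcs G)))"
    using Suc.prems Suc.IH by (intro sum.cong) (auto simp: adjacency_matrix_def)
  also have "\<dots> = of_nat (walks G (Suc k) (vs ! i) (vs ! j))"
    by (subst sum_nth_distinct[OF assms(1)]) (simp add: assms(2))
  finally show ?case .
qed

lemma power_sum_adjacency_spectrum:
  assumes "pair_graph G"
  shows "(\<Sum>e\<in>#adjacency_spectrum G. e ^ k) = of_nat (closed_walks G k)"
proof -
  interpret pair_graph G by (rule assms)
  obtain vs where vs: "distinct vs" "set vs = pverts G"
    using finite_distinct_list[OF pair_finite_verts] by metis
  have "adjacency_matrix G vs \<in> carrier_mat (length vs) (length vs)"
    by (simp add: adjacency_matrix_def)
  then have "(\<Sum>e\<in>#adjacency_spectrum G. e ^ k)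
      = (\<Sum>i<length vs. (adjacency_matrix G vs ^\<^sub>m k) $$ (i, i))"
    unfolding adjacency_spectrum_eq[OF vs] by (rule power_sum_proots_char_poly)
  also have "\<dots> = (\<Sum>i = 0..<length vs. of_nat (walks G k (vs ! i) (vs ! i)))"
    using adjacency_matrix_pow[OF vs] by (simp add: lessThan_atLeast0)
  also have "\<dots> = of_nat (closed_walks G k)"
    by (subst sum_nth_distinct[OF vs(1)]) (simp add: vs(2) closed_walks_def)
  finally show ?thesis .
qed

text \<open>Trades the complex spectrum for natural numbers, so that cospectrality becomes a matter
  of counting. Length 0 is among the conditions and carries the number of vertices.\<close>

lemma cospectral_iff_closed_walks:
  assumes "pair_graph G" "pair_graph H"
  shows "cospectral G H \<longleftrightarrow> (\<forall>k. closed_walks G k = closed_walks H k)"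
proof
  assume "cospectral G H"
  then have "(of_nat (closed_walks G k) :: complex) = of_nat (closed_walks H k)" for k
    using power_sum_adjacency_spectrum assms unfolding cospectral_def by metis
  then show "\<forall>k. closed_walks G k = closed_walks H k" by simp
next
  assume "\<forall>k. closed_walks G k = closed_walks H k"
  then show "cospectral G H"
    unfolding cospectral_def
    by (intro mset_eqI_power_sums) (simp add: power_sum_adjacency_spectrum assms)
qed

lemma closed_walks_0: "closed_walks G 0 = card (pverts G)"
  by (simp add: closed_walks_def)

section \<open>Walk counts in a simple graph\<close>

context pair_graph
begin

lemma arc_sym: "(u, v) \<in> parcs G \<longleftrightarrow> (v, u) \<in> parcs G"
  using pair_sym_arcs by (auto simp: symmetric_def sym_def)

lemma walks_1: "u \<in> pverts G \<Longrightarrow> walks G 1 u v = of_bool ((u, v) \<in> parcs G)"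
  using pair_finite_verts by (simp add: of_bool_def if_distrib[of "\<lambda>c. c * _"] cong: if_cong)

text \<open>A walk of length k + l is cut at the vertex reached after k steps.\<close>

lemma walks_add:
  assumes "v \<in> pverts G"
  shows "walks G (k + l) u v = (\<Sum>w\<in>pverts G. walks G k u w * walks G l w v)"
  using assms
proof (induction l arbitrary: v)
  case 0
  then show ?case
    using pair_finite_verts by (simp add: of_bool_def if_distrib[of "\<lambda>c. _ * c"] cong: if_cong)
next
  case (Suc l)
  have "walks G (k + Suc l) u v =
      (\<Sum>x\<in>pverts G. \<Sum>w\<in>pverts G. walks G k u w * (walks G l w x * of_bool ((x, v) \<in> parcs G)))"
    using Suc.IH by (auto simp only: walks.simps add_Suc_right sum_distrib_right mult.assoc
        intro!: sum.cong)
  also have "\<dots> = (\<Sum>w\<in>pverts G. walks G k u w * walks G (Suc l) w v)"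
    by (subst sum.swap) (simp only: walks.simps sum_distrib_left)
  finally show ?case .
qed

lemma walks_sym:
  assumes "u \<in> pverts G" "v \<in> pverts G"
  shows "walks G k u v = walks G k v u"
  using assms
proof (induction k arbitrary: u v)
  case (Suc k)
  \<comment> \<open>The recursion splits off the last step. Reversal turns it into a first step,
    which \<open>walks_add\<close> then puts in front.\<close>
  have "walks G (Suc k) u v = (\<Sum>w\<in>pverts G. walks G 1 v w * walks G k w u)"
    using Suc by (auto simp: walks_1 arc_sym[of _ v] mult.commute simp del: One_nat_def
        intro!: sum.cong)
  also have "\<dots> = walks G (Suc k) v u"
    using walks_add[of u 1 k v] Suc.prems by simp
  finally show ?case .
qed auto

text \<open>The left side is the Frobenius inner product of A^k and A^l; by symmetry of A^l it is
  the trace of A^(k+l).\<close>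

lemma sum_walks_mult:
  "(\<Sum>u\<in>pverts G. \<Sum>v\<in>pverts G. walks G k u v * walks G l u v) = closed_walks G (k + l)"
  unfolding closed_walks_def
proof (rule sum.cong[OF refl])
  fix u assume u: "u \<in> pverts G"
  show "(\<Sum>v\<in>pverts G. walks G k u v * walks G l u v) = walks G (k + l) u u"
    unfolding walks_add[OF u] by (intro sum.cong refl arg_cong2[where f = "(*)"] walks_sym u)
qed

lemma closed_walks_1: "closed_walks G 1 = 0"
  by (auto simp: closed_walks_def walks_1 simp del: One_nat_def dest: pair_no_loops)

lemma closed_walks_2: "closed_walks G 2 = card (parcs G)"
proof -
  have "closed_walks G 2 = (\<Sum>(u, v)\<in>pverts G \<times> pverts G. of_bool ((u, v) \<in> parcs G))"
    unfolding sum.cartesian_product[symmetric] one_add_one[symmetric] sum_walks_mult[symmetric]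
    by (intro sum.cong refl) (simp add: walks_1 del: walks.simps One_nat_def)
  also have "\<dots> = card (parcs G \<inter> pverts G \<times> pverts G)"
    using pair_finite_verts by (simp add: split_def Int_commute)
  also have "parcs G \<inter> pverts G \<times> pverts G = parcs G"
    using wellformed' by auto
  finally show ?thesis .
qed

text \<open>A walk of length 3 with given ends amounts to its pair of inner vertices.\<close>

lemma walks_3:
  assumes "u \<in> pverts G" "v \<in> pverts G"
  shows "walks G 3 u v = card {(x, y). (u, x) \<in> parcs G \<and> (x, y) \<in> parcs G \<and> (y, v) \<in> parcs G}"
proof -
  have "walks G 3 u v = (\<Sum>y\<in>pverts G. \<Sum>x\<in>pverts G.
      walks G 1 u x * walks G 1 x y * walks G 1 y v)"
    using assms walks_add[of v 2 1 u] walks_add[of _ 1 1 u]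
    by (simp add: sum_distrib_right numeral_2_eq_2 numeral_3_eq_3 del: walks.simps)
  also have "\<dots> = (\<Sum>y\<in>pverts G. \<Sum>x\<in>pverts G.
      of_bool ((u, x) \<in> parcs G \<and> (x, y) \<in> parcs G \<and> (y, v) \<in> parcs G))"
    using assms by (intro sum.cong refl) (simp add: walks_1 del: One_nat_def)
  also have "\<dots> = (\<Sum>(x, y)\<in>pverts G \<times> pverts G.
      of_bool ((u, x) \<in> parcs G \<and> (x, y) \<in> parcs G \<and> (y, v) \<in> parcs G))"
    by (subst sum.swap) (simp only: sum.cartesian_product)
  also have "\<dots> = card ((pverts G \<times> pverts G) \<inter>
      {(x, y). (u, x) \<in> parcs G \<and> (x, y) \<in> parcs G \<and> (y, v) \<in> parcs G})"
    using pair_finite_verts by (simp add: split_def)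
  also have "(pverts G \<times> pverts G) \<inter>
      {(x, y). (u, x) \<in> parcs G \<and> (x, y) \<in> parcs G \<and> (y, v) \<in> parcs G} =
      {(x, y). (u, x) \<in> parcs G \<and> (x, y) \<in> parcs G \<and> (y, v) \<in> parcs G}"
    using wellformed' by auto
  finally show ?thesis .
qed

end

section \<open>Complete bipartite graphs with isolated vertices\<close>

text \<open>Vertices outside \<open>U\<close> and \<open>V\<close> are allowed and are isolated.
  Naming the sides inside the vertex set of \<open>G\<close> describes complete bipartite graphs
  with isolated vertices without passing to an isomorphic copy.\<close>

definition biclique :: "'a pair_pre_digraph \<Rightarrow> 'a set \<Rightarrow> 'a set \<Rightarrow> bool" where
  "biclique G U V \<longleftrightarrow> finite (pverts G) \<and> U \<subseteq> pverts G \<and> V \<subseteq> pverts G \<and> U \<inter> V = {} \<and>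
    parcs G = U \<times> V \<union> V \<times> U"

lemma biclique_commute: "biclique G U V \<longleftrightarrow> biclique G V U"
  by (auto simp: biclique_def)

lemma pair_graph_biclique:
  assumes "biclique G U V"
  shows "pair_graph G"
proof
  show "symmetric (with_proj G)"
    using assms by (auto simp: symmetric_def sym_def biclique_def)
  show "finite (parcs G)"
    using assms by (auto simp: biclique_def intro: finite_subset)
qed (use assms in \<open>auto simp: biclique_def\<close>)

lemma card_parcs_biclique:
  assumes "biclique G U V"
  shows "card (parcs G) = 2 * (card U * card V)"
proof -
  have fin: "finite U" "finite V" using assms by (auto simp: biclique_def intro: finite_subset)
  have "parcs G = U \<times> V \<union> V \<times> U" "U \<times> V \<inter> V \<times> U = {}"
    using assms by (auto simp: biclique_def)
  then have "card (parcs G) = card (U \<times> V) + card (V \<times> U)"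
    using fin by (simp only: card_Un_disjoint finite_cartesian_product)
  then show ?thesis by (simp add: card_cartesian_product)
qed

text \<open>This is A^3 = c A. A walk changes sides at every step, so after three steps it ends
  opposite its start, at an adjacent vertex. Conversely, between adjacent ends the two inner
  vertices range freely over the two sides.\<close>

lemma walks_3_biclique:
  assumes G: "biclique G U V" and uv: "u \<in> pverts G" "v \<in> pverts G"
  shows "walks G 3 u v = card U * card V * walks G 1 u v"
proof -
  interpret pair_graph G by (rule pair_graph_biclique[OF G])
  let ?S = "{(x, y). (u, x) \<in> parcs G \<and> (x, y) \<in> parcs G \<and> (y, v) \<in> parcs G}"
  have UV: "U \<inter> V = {}" "parcs G = U \<times> V \<union> V \<times> U"
    using G by (auto simp: biclique_def)
  consider "(u, v) \<in> U \<times> V" | "(u, v) \<in> V \<times> U" | "(u, v) \<notin> parcs G"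
    using UV by auto
  then have "card ?S = card U * card V * of_bool ((u, v) \<in> parcs G)"
  proof cases
    case 1
    then have "?S = V \<times> U" using UV by auto
    then show ?thesis using 1 UV(2) by (simp add: card_cartesian_product)
  next
    case 2
    then have "?S = U \<times> V" using UV by auto
    then show ?thesis using 2 UV(2) by (simp add: card_cartesian_product)
  next
    case 3
    then have "?S = {}" using UV by auto
    then show ?thesis using 3 by (simp only: card.empty) simp
  qed
  then show ?thesis using uv by (simp add: walks_3 walks_1 del: One_nat_def)
qed

text \<open>Multiply A^3 = c A by A^k and take traces.\<close>

lemma closed_walks_biclique_step:
  assumes G: "biclique G U V"
  shows "closed_walks G (k + 3) = card U * card V * closed_walks G (k + 1)"
proof -
  interpret pair_graph G by (rule pair_graph_biclique[OF G])
  have "walks G (k + 3) v v = card U * card V * walks G (k + 1) v v" if "v \<in> pverts G" for v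
    using that by (simp add: walks_add walks_3_biclique[OF G] sum_distrib_left mult_ac
        del: walks.simps One_nat_def add_Suc_right)
  then show ?thesis by (simp add: closed_walks_def sum_distrib_left)
qed

text \<open>The recurrence covers all lengths from 3 on. The remaining counts agree too: length 0
  gives the number of vertices, length 1 gives 0, and length 2 gives the number of arcs.\<close>

lemma closed_walks_biclique_eq:
  assumes G: "biclique G U V" and H: "biclique H U' V'"
    and eq: "card (pverts G) = card (pverts H)" "card U * card V = card U' * card V'"
  shows "closed_walks G k = closed_walks H k"
proof (induction k rule: less_induct)
  case (less k)
  note gr = pair_graph_biclique[OF G] pair_graph_biclique[OF H]
  consider "k = 0" | "k = 1" | "k = 2" | l where "k = l + 3"
    by (metis One_nat_def Suc_1 add.commute add_2_eq_Suc' not0_implies_Suc numeral_3_eq_3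
        plus_1_eq_Suc add_Suc_right)
  then show ?case
  proof cases
    case 4
    then show ?thesis
      using less.IH[of "l + 1"] closed_walks_biclique_step[OF G] closed_walks_biclique_step[OF H] eq
      by simp
  qed (use gr eq card_parcs_biclique[OF G] card_parcs_biclique[OF H] in
      \<open>simp_all add: closed_walks_0 pair_graph.closed_walks_1 pair_graph.closed_walks_2
        del: One_nat_def\<close>)
qed

text \<open>The two sides and the set of isolated vertices are matched separately by cardinality.
  The glued bijection respects arcs because these are products of the sides.\<close>

lemma digraph_iso_biclique:
  assumes G: "biclique G U V" and H: "biclique H U' V'"
    and eq: "card (pverts G) = card (pverts H)" "card U = card U'" "card V = card V'"
  shows "digraph_iso (with_proj G) (with_proj H)"
proof -
  let ?W = "pverts G - U - V" and ?W' = "pverts H - U' - V'"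
  have sub: "finite (pverts G)" "U \<subseteq> pverts G" "V \<subseteq> pverts G" "U \<inter> V = {}"
      "finite (pverts H)" "U' \<subseteq> pverts H" "V' \<subseteq> pverts H" "U' \<inter> V' = {}"
    using G H by (auto simp: biclique_def)
  then have fin: "finite U" "finite V" "finite U'" "finite V'" by (auto intro: finite_subset)
  have "card (pverts G - U - V) = card (pverts G) - card U - card V"
    using sub fin by (subst card_Diff_subset; (subst card_Diff_subset)?) auto
  moreover have "card (pverts H - U' - V') = card (pverts H) - card U' - card V'"
    using sub fin by (subst card_Diff_subset; (subst card_Diff_subset)?) auto
  ultimately have W: "card ?W = card ?W'" using eq by simp
  obtain f where f: "bij_betw f U U'" using finite_same_card_bij[OF fin(1,3) eq(2)] by blast
  obtain g where g: "bij_betw g V V'" using finite_same_card_bij[OF fin(2,4) eq(3)] by blast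
  obtain h where h: "bij_betw h ?W ?W'" using finite_same_card_bij[OF _ _ W] sub by blast
  define F where "F x = (if x \<in> U then f x else if x \<in> V then g x else h x)" for x
  have FU: "bij_betw F U U'"
    by (rule bij_betw_cong[THEN iffD2, OF _ f]) (simp add: F_def)
  have FV: "bij_betw F V V'"
    by (rule bij_betw_cong[THEN iffD2, OF _ g]) (use sub in \<open>auto simp: F_def\<close>)
  have FW: "bij_betw F ?W ?W'"
    by (rule bij_betw_cong[THEN iffD2, OF _ h]) (auto simp: F_def)
  have "bij_betw F (U \<union> V) (U' \<union> V')"
    by (rule bij_betw_combine[OF FU FV]) (use sub in auto)
  then have "bij_betw F ((U \<union> V) \<union> ?W) ((U' \<union> V') \<union> ?W')"
    by (rule bij_betw_combine[OF _ FW]) auto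
  moreover have "(U \<union> V) \<union> ?W = pverts G" "(U' \<union> V') \<union> ?W' = pverts H" using sub by auto
  ultimately have F: "inj_on F (pverts G)" "pverts H = F ` pverts G"
    by (auto simp: bij_betw_def)
  have im: "F ` U = U'" "F ` V = V'" using FU FV by (auto simp: bij_betw_def)
  have "parcs H = map_prod F F ` parcs G"
  proof -
    have "parcs G = U \<times> V \<union> V \<times> U" "parcs H = U' \<times> V' \<union> V' \<times> U'"
      using G H by (auto simp: biclique_def)
    then show ?thesis unfolding im[symmetric] by (auto simp: image_Un map_prod_surj_on)
  qed
  then show ?thesis
    using digraph_iso_image[OF pair_graph_biclique[OF G] F(1) F(2)] by blast
qed

section \<open>The given graph constructions as bicliques\<close>

lemma biclique_complete_bipartite:
  "biclique (complete_bipartite p q) (Inl ` {..<p}) (Inr ` {..<q})"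
  by (auto simp: biclique_def complete_bipartite_def)

lemma biclique_disjoint_union_empty:
  assumes "biclique G U V" "empty_graph H"
  shows "biclique (disjoint_union G H) (Inl ` U) (Inl ` V)"
proof -
  interpret H: pair_graph H using assms by (simp add: empty_graph_def)
  have "map_prod Inl Inl ` parcs G = Inl ` U \<times> Inl ` V \<union> Inl ` V \<times> Inl ` U"
    using assms(1) by (simp add: biclique_def image_Un map_prod_surj_on)
  then show ?thesis
    using assms H.pair_finite_verts
    by (auto simp: biclique_def disjoint_union_def empty_graph_def)
qed

lemma card_pverts_complete_bipartite: "card (pverts (complete_bipartite p q)) = p + q"
proof -
  have "card (Inl ` {..<p} \<union> Inr ` {..<q}) = p + q"
    by (subst card_Un_disjoint) (auto simp: card_image)
  then show ?thesis by (simp add: complete_bipartite_def)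
qed

lemma card_pverts_disjoint_union:
  assumes "finite (pverts G)" "finite (pverts H)"
  shows "card (pverts (disjoint_union G H)) = card (pverts G) + card (pverts H)"
proof -
  have "card (Inl ` pverts G \<union> Inr ` pverts H) = card (pverts G) + card (pverts H)"
    using assms by (subst card_Un_disjoint) (auto simp: card_image)
  then show ?thesis by (simp add: disjoint_union_def)
qed

section \<open>Recovering a biclique from closed walk counts\<close>

text \<open>
  The counts of closed walks of lengths 2, 4 and 6 force the matrix \<open>A\<^sup>3 - c A\<close>, with \<open>A\<close> the
  adjacency matrix, to have vanishing Frobenius norm.
\<close>

lemma (in pair_graph) walks_3_eqI:
  assumes "closed_walks G 4 = c * closed_walks G 2" "closed_walks G 6 = c * closed_walks G 4"
    and uv: "u \<in> pverts G" "v \<in> pverts G"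
  shows "walks G 3 u v = c * walks G 1 u v"
proof -
  let ?w = "\<lambda>k u v. int (walks G k u v)" and ?V = "pverts G"
  have sw: "(\<Sum>u\<in>?V. \<Sum>v\<in>?V. ?w k u v * ?w l u v) = int (closed_walks G (k + l))" for k l
    by (simp flip: sum_walks_mult)
  \<comment> \<open>The three double sums are the closed walk counts of lengths 6, 4 and 2. With w
    the count of length 2, the total is c^2 w - 2 c^2 w + c^2 w.\<close>
  have "(\<Sum>u\<in>?V. \<Sum>v\<in>?V. (?w 3 u v - int c * ?w 1 u v)\<^sup>2) =
      (\<Sum>u\<in>?V. \<Sum>v\<in>?V. ?w 3 u v * ?w 3 u v)
      - 2 * int c * (\<Sum>u\<in>?V. \<Sum>v\<in>?V. ?w 3 u v * ?w 1 u v)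
      + (int c)\<^sup>2 * (\<Sum>u\<in>?V. \<Sum>v\<in>?V. ?w 1 u v * ?w 1 u v)"
    by (simp add: sum_distrib_left sum.distrib sum_subtractf power2_eq_square algebra_simps
        del: walks.simps One_nat_def)
  also have "\<dots> = 0"
    using assms(1,2) by (simp only: sw numeral_Bit0 numeral_Bit1 numeral_One)
      (simp add: power2_eq_square numeral_eq_Suc)
  finally have "(\<Sum>u\<in>?V. \<Sum>v\<in>?V. (?w 3 u v - int c * ?w 1 u v)\<^sup>2) = 0" .
  then have "?w 3 u v - int c * ?w 1 u v = 0"
    using uv pair_finite_verts
    by (simp add: sum_nonneg_eq_0_iff sum_nonneg del: walks.simps One_nat_def)
  then have "?w 3 u v = int (c * walks G 1 u v)" by simp
  then show ?thesis by (simp only: of_nat_eq_iff)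
qed

lemma (in pair_graph) biclique_of_closed_walks:
  assumes c: "c > 0" and cw2: "closed_walks G 2 = 2 * c"
    and cw: "closed_walks G 4 = c * closed_walks G 2" "closed_walks G 6 = c * closed_walks G 4"
  shows "\<exists>U V. biclique G U V \<and> card U * card V = c"
proof -
  have card_arcs: "card (parcs G) = 2 * c" using cw2 closed_walks_2 by simp
  then have "parcs G \<noteq> {}" using c by auto
  then obtain u v where uv: "(u, v) \<in> parcs G" by (metis ex_in_conv surj_pair)
  define U V where "U = {x. (x, v) \<in> parcs G}" and "V = {x. (u, x) \<in> parcs G}"
  \<comment> \<open>A walk of length 3 makes an entry of A^3 = c A nonzero, hence also that entry of
    A.\<close>
  have closed: "(x, y) \<in> parcs G"
    if "(x, x') \<in> parcs G" "(x', y') \<in> parcs G" "(y', y) \<in> parcs G" for x x' y' y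
  proof -
    let ?S = "{(x', y'). (x, x') \<in> parcs G \<and> (x', y') \<in> parcs G \<and> (y', y) \<in> parcs G}"
    have "finite ?S" by (rule finite_subset[OF _ pair_finite_arcs]) auto
    then have "card ?S \<noteq> 0" using that by auto
    moreover have xy: "x \<in> pverts G" "y \<in> pverts G" using that wellformed' by auto
    ultimately have "walks G 1 x y \<noteq> 0"
      using walks_3_eqI[OF cw xy] walks_3[OF xy] by (metis mult_0_right)
    then show ?thesis unfolding walks_1[OF xy(1)] by simp
  qed
  have sub: "U \<subseteq> pverts G" "V \<subseteq> pverts G" using wellformed' by (auto simp: U_def V_def)
  \<comment> \<open>For x in \<open>U\<close> and y in \<open>V\<close>, the walk x, v, u, y has
    length 3.\<close>
  have UV: "U \<times> V \<subseteq> parcs G"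
    using closed arc_sym uv by (fastforce simp: U_def V_def)
  have VU: "V \<times> U \<subseteq> parcs G" using UV arc_sym by auto
  \<comment> \<open>A common vertex would carry a loop.\<close>
  have disj: "U \<inter> V = {}" using UV pair_no_loops by fastforce
  \<comment> \<open>An auxiliary graph that serves to count the arcs between \<open>U\<close> and
    \<open>V\<close>; that these are all arcs of \<open>G\<close> is not yet known.\<close>
  have "biclique \<lparr> pverts = pverts G, parcs = U \<times> V \<union> V \<times> U \<rparr> U V"
    using sub disj pair_finite_verts by (auto simp: biclique_def)
  from card_parcs_biclique[OF this]
  have card_UV: "card (U \<times> V \<union> V \<times> U) = 2 * (card U * card V)" by simp
  \<comment> \<open>The count of walks of length 3 from u to v is c by A^3 = c A, and it is also the
    size of this product.\<close>
  have "{(x, y). (u, x) \<in> parcs G \<and> (x, y) \<in> parcs G \<and> (y, v) \<in> parcs G} = V \<times> U"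
    using VU by (auto simp: U_def V_def)
  then have c_eq: "card U * card V = c"
    using walks_3_eqI[OF cw, of u v] walks_3[of u v] walks_1[of u v] uv wellformed'[OF uv]
    by (simp add: card_cartesian_product mult.commute del: walks.simps One_nat_def)
  \<comment> \<open>Both sets have 2 c elements, so the inclusion is an equality.\<close>
  have "U \<times> V \<union> V \<times> U = parcs G"
    by (rule card_subset_eq[OF pair_finite_arcs]) (use UV VU card_UV c_eq card_arcs in auto)
  then show ?thesis
    using sub disj pair_finite_verts c_eq by (auto simp: biclique_def)
qed

lemma cospectral_biclique_imp_biclique:
  assumes G: "pair_graph G" and H: "biclique H U V" and co: "cospectral G H"
    and pos: "card U * card V > 0"
  shows "\<exists>U' V'. biclique G U' V' \<and> card U' * card V' = card U * card V"
proof -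
  have cw: "closed_walks G k = closed_walks H k" for k
    using co cospectral_iff_closed_walks[OF G pair_graph_biclique[OF H]] by blast
  show ?thesis
  proof (rule pair_graph.biclique_of_closed_walks[OF G pos])
    show "closed_walks G 2 = 2 * (card U * card V)"
      using cw pair_graph.closed_walks_2[OF pair_graph_biclique[OF H]] card_parcs_biclique[OF H]
      by simp
    show "closed_walks G 4 = card U * card V * closed_walks G 2"
      using closed_walks_biclique_step[OF H, of 1] cw by (simp add: numeral_eq_Suc)
    show "closed_walks G 6 = card U * card V * closed_walks G 4"
      using closed_walks_biclique_step[OF H, of 3] cw by (simp add: numeral_eq_Suc)
  qed
qed

text \<open>The common start of both claims. The bound on \<open>card U + card V\<close> holds
  because the sides are disjoint sets among p + q vertices; AM-minimality will turn it into an
  equality.\<close>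

lemma cospectral_complete_bipartite_imp_biclique:
  assumes pq: "p > 0" "q > 0" and G: "pair_graph G"
    and co: "cospectral G (complete_bipartite p q)"
  obtains U V where "biclique G U V" "card U * card V = p * q" "card U > 0" "card V > 0"
    "card (pverts G) = p + q" "card U + card V \<le> p + q"
proof -
  have c: "card (Inl ` {..<p} :: (nat + nat) set) * card (Inr ` {..<q} :: (nat + nat) set) = p * q"
    by (simp add: card_image)
  then obtain U V where UV: "biclique G U V" "card U * card V = p * q"
    using cospectral_biclique_imp_biclique[OF G biclique_complete_bipartite co] pq by auto
  have "card (pverts G) = p + q"
    using co cospectral_iff_closed_walks[OF G pair_graph_complete_bipartite]
    by (metis closed_walks_0 card_pverts_complete_bipartite)
  moreover have "card U + card V \<le> card (pverts G)"
  proof -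
    have "card U + card V = card (U \<union> V)"
      using UV(1) by (subst card_Un_disjoint) (auto simp: biclique_def intro: finite_subset)
    also have "\<dots> \<le> card (pverts G)"
      using UV(1) by (intro card_mono) (auto simp: biclique_def)
    finally show ?thesis .
  qed
  moreover have "card U > 0" "card V > 0" using UV(2) pq by (metis mult_is_0 neq0_conv)+
  ultimately show thesis using that[OF UV] by simp
qed

section \<open>Adding isolated vertices to a complete bipartite graph\<close>

lemma empty_graph_no_arcs: "finite A \<Longrightarrow> empty_graph \<lparr> pverts = A, parcs = {} \<rparr>"
  using pair_graph_biclique[of "\<lparr> pverts = A, parcs = {} \<rparr>" "{}" "{}"]
  by (simp add: empty_graph_def biclique_def)

text \<open>Provides the graph to which a cospectral graph is isomorphic, and also the
  counterexample when p + q is not minimal.\<close>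

lemma complete_bipartite_union_isolated:
  obtains H :: "nat pair_pre_digraph" where "empty_graph H" "card (pverts H) = m"
    "biclique (disjoint_union (complete_bipartite a b) H) (Inl ` Inl ` {..<a}) (Inl ` Inr ` {..<b})"
    "card (pverts (disjoint_union (complete_bipartite a b) H)) = a + b + m"
proof -
  define H :: "nat pair_pre_digraph" where "H = \<lparr> pverts = {..<m}, parcs = {} \<rparr>"
  have H: "empty_graph H" "card (pverts H) = m" "finite (pverts H)"
    using empty_graph_no_arcs[of "{..<m}"] by (simp_all add: H_def)
  have "finite (pverts (complete_bipartite a b))" by (simp add: complete_bipartite_def)
  then have "card (pverts (disjoint_union (complete_bipartite a b) H)) = a + b + m"
    using card_pverts_disjoint_union[of "complete_bipartite a b" H] H by (simp add: card_pverts_complete_bipartite)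
  then show thesis
    by (rule that[OF H(1,2) biclique_disjoint_union_empty[OF biclique_complete_bipartite H(1)]])
qed

text \<open>Tells a complete bipartite graph with nonempty sides from one with isolated vertices
  added: every vertex of the former is the tail of an arc, and an isomorphism pulls this
  back.\<close>

lemma no_isolated_vertex_if_iso_complete_bipartite:
  assumes iso: "digraph_iso (with_proj G) (with_proj (complete_bipartite p q))"
    and pq: "p > 0" "q > 0" and v: "v \<in> pverts G"
  shows "\<exists>e\<in>parcs G. fst e = v"
proof -
  let ?K = "complete_bipartite p q"
  obtain h where h: "pre_digraph.digraph_isomorphism (with_proj G) h"
      "with_proj ?K = app_iso h (with_proj G)"
    using iso unfolding digraph_iso_def by blast
  have V: "pverts ?K = iso_verts h ` pverts G" and A: "parcs ?K = iso_arcs h ` parcs G"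
    and th: "iso_tail h = fst"
    using h(2) by (simp_all add: app_iso_def with_proj_def)
  have inj: "inj_on (iso_verts h) (pverts G)" and wf: "wf_digraph (with_proj G)"
    and tail: "\<And>e. e \<in> parcs G \<Longrightarrow> iso_verts h (fst e) = fst (iso_arcs h e)"
    using h(1) by (auto simp: pre_digraph.digraph_isomorphism_def th)
  have "\<exists>e\<in>parcs ?K. fst e = x" if "x \<in> pverts ?K" for x
  proof -
    \<comment> \<open>Positivity of p and q puts 0 on both sides, so x has a neighbour on the
      opposite one.\<close>
    have "(x, if isl x then Inr 0 else Inl 0) \<in> parcs ?K"
      using that pq by (auto simp: complete_bipartite_def)
    then show ?thesis by force
  qed
  then obtain e where e: "e \<in> parcs G" "fst (iso_arcs h e) = iso_verts h v"
    using v unfolding V A by blast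
  have "fst e \<in> pverts G" using wf_digraph.tail_in_verts[OF wf] e(1) by simp
  then have "fst e = v" using inj v e tail by (metis inj_onD)
  with e(1) show ?thesis by blast
qed

section \<open>AM-minimizers\<close>

text \<open>The mean of p and q belongs to the set, so it is the minimum exactly if it is a lower
  bound.\<close>

lemma AM_minimizer_iff:
  assumes "p > 0" "q > 0"
  shows "AM_minimizer p q \<longleftrightarrow> (\<forall>a b. a > 0 \<and> b > 0 \<and> a * b = p * q \<longrightarrow> p + q \<le> a + b)"
proof -
  let ?S = "{(real a + real b) / 2 | a b :: nat. a > 0 \<and> b > 0 \<and> a * b = p * q}"
  have fin: "finite ?S" by (rule AM_minimizer_set_finite[OF assms])
  have mem: "(real p + real q) / 2 \<in> ?S" using assms by blast
  have "AM_minimizer p q \<longleftrightarrow> (\<forall>x\<in>?S. (real p + real q) / 2 \<le> x)"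
    unfolding AM_minimizer_def eq_commute[of _ "Min ?S"]
    using Min_eq_iff[OF fin] mem by blast
  also have "\<dots> \<longleftrightarrow> (\<forall>a b. a > 0 \<and> b > 0 \<and> a * b = p * q \<longrightarrow>
      (real p + real q) / 2 \<le> (real a + real b) / 2)"
    by blast
  also have "\<dots> \<longleftrightarrow> (\<forall>a b. a > 0 \<and> b > 0 \<and> a * b = p * q \<longrightarrow> p + q \<le> a + b)"
    by (simp add: divide_le_cancel flip: of_nat_add)
  finally show ?thesis .
qed

text \<open>By Vieta, a is a root of (X - p)(X - q). The computation runs over the integers because
  of the subtractions.\<close>

lemma sum_prod_eq_imp:
  fixes a b p q :: nat
  assumes "a + b = p + q" "a * b = p * q"
  shows "a = p \<and> b = q \<or> a = q \<and> b = p"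
proof -
  have s: "int a + int b = int p + int q" and m: "int a * int b = int p * int q"
    using assms by (simp_all flip: of_nat_add of_nat_mult)
  have "(int a - int p) * (int a - int q) = int a * int a - int a * (int p + int q) + int p * int q"
    by (simp add: algebra_simps)
  also have "\<dots> = 0"
    by (simp only: s[symmetric] m[symmetric]) (simp add: algebra_simps)
  finally have "(int a - int p) * (int a - int q) = 0" .
  then show ?thesis using assms(1) by auto
qed

theorem theorem2p4p7:
  fixes p q :: nat
  assumes "p > 0" and "q > 0"
  shows "(\<forall>G :: 'a pair_pre_digraph.
            pair_graph G \<and> cospectral G (complete_bipartite p q) \<longrightarrow>
            (\<exists>(a :: nat) (b :: nat) (H :: nat pair_pre_digraph).
               a > 0 \<and> b > 0 \<and> sqrt (real (a * b)) = sqrt (real (p * q)) \<and> empty_graph H \<and>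
               digraph_iso (with_proj G) (with_proj (disjoint_union (complete_bipartite a b) H))))
       \<and> (determined_by_spectrum (complete_bipartite p q) \<longleftrightarrow> AM_minimizer p q)"
proof (intro conjI allI impI)
  fix G :: "'a pair_pre_digraph"
  assume G: "pair_graph G \<and> cospectral G (complete_bipartite p q)"
  obtain U V where UV: "biclique G U V" "card U * card V = p * q" "card U > 0" "card V > 0"
      "card (pverts G) = p + q" "card U + card V \<le> p + q"
    by (rule cospectral_complete_bipartite_imp_biclique[OF assms G[THEN conjunct1] G[THEN conjunct2]])
  let ?a = "card U" and ?b = "card V"
  \<comment> \<open>\<open>H\<close> supplies the vertices of \<open>G\<close> outside both sides;
    the truncated subtraction is exact by the bound on \<open>card U + card V\<close>.\<close>
  obtain H :: "nat pair_pre_digraph" where H: "empty_graph H"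
    "biclique (disjoint_union (complete_bipartite ?a ?b) H)
      (Inl ` Inl ` {..<?a}) (Inl ` Inr ` {..<?b})"
    "card (pverts (disjoint_union (complete_bipartite ?a ?b) H)) = ?a + ?b + (p + q - (?a + ?b))"
    by (rule complete_bipartite_union_isolated)
  have "digraph_iso (with_proj G) (with_proj (disjoint_union (complete_bipartite ?a ?b) H))"
    by (rule digraph_iso_biclique[OF UV(1) H(2)]) (use UV H(3) in \<open>simp_all add: card_image\<close>)
  with UV(2-4) H(1) show "\<exists>a b (H :: nat pair_pre_digraph).
      a > 0 \<and> b > 0 \<and> sqrt (real (a * b)) = sqrt (real (p * q)) \<and> empty_graph H \<and>
      digraph_iso (with_proj G) (with_proj (disjoint_union (complete_bipartite a b) H))"
    by metis
next
  let ?K = "complete_bipartite p q"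
  note K = biclique_complete_bipartite[of p q]
  show "determined_by_spectrum ?K \<longleftrightarrow> AM_minimizer p q"
    unfolding AM_minimizer_iff[OF assms]
  proof (intro iffI allI impI)
    fix a b :: nat
    assume ds: "determined_by_spectrum ?K" and ab: "a > 0 \<and> b > 0 \<and> a * b = p * q"
    show "p + q \<le> a + b"
    proof (rule ccontr)
      assume less: "\<not> p + q \<le> a + b"
      let ?U = "Inl ` Inl ` {..<a} :: ((nat + nat) + nat) set"
        and ?V = "Inl ` Inr ` {..<b} :: ((nat + nat) + nat) set"
      \<comment> \<open>Isolated vertices fill up the smaller graph to p + q vertices. With the
        equal product a b = p q, this makes it cospectral with \<open>?K\<close>.\<close>
      obtain H :: "nat pair_pre_digraph" where H: "card (pverts H) = p + q - (a + b)"
        "biclique (disjoint_union (complete_bipartite a b) H) ?U ?V"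
        "card (pverts (disjoint_union (complete_bipartite a b) H)) = a + b + (p + q - (a + b))"
        by (rule complete_bipartite_union_isolated)
      let ?D = "disjoint_union (complete_bipartite a b) H"
      have "closed_walks ?D k = closed_walks ?K k" for k
        by (rule closed_walks_biclique_eq[OF H(2) K])
          (use H(3) less ab in \<open>simp_all add: card_image card_pverts_complete_bipartite\<close>)
      then have "cospectral ?D ?K"
        using cospectral_iff_closed_walks pair_graph_biclique[OF H(2)] pair_graph_biclique[OF K]
        by blast
      \<comment> \<open>\<open>?D\<close> has vertices in a sum type, whereas
        \<open>determined_by_spectrum\<close> ranges over graphs on \<open>nat\<close>;
        \<open>determined_by_spectrumD\<close> bridges the gap.\<close>
      with ds have "digraph_iso (with_proj ?D) (with_proj ?K)"
        by (rule determined_by_spectrumD[OF _ pair_graph_biclique[OF H(2)]])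
      \<comment> \<open>As a + b < p + q, the graph \<open>H\<close> has a vertex; it is isolated in
        \<open>?D\<close>, which contradicts the isomorphism with \<open>?K\<close>.\<close>
      moreover obtain w where "w \<in> pverts H"
        using H(1) less by fastforce
      then have "Inr w \<in> pverts ?D" by (simp add: disjoint_union_def)
      ultimately have "\<exists>e\<in>parcs ?D. fst e = Inr w"
        by (rule no_isolated_vertex_if_iso_complete_bipartite[OF _ assms])
      then show False using H(2) by (auto simp: biclique_def)
    qed
  next
    assume min: "\<forall>a b. a > 0 \<and> b > 0 \<and> a * b = p * q \<longrightarrow> p + q \<le> a + b"
    show "determined_by_spectrum ?K"
      unfolding determined_by_spectrum_def
    proof (intro allI impI)
      fix G :: "nat pair_pre_digraph"
      assume G: "pair_graph G \<and> cospectral G ?K"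
      obtain U V where UV: "biclique G U V" "card U * card V = p * q" "card U > 0" "card V > 0"
        "card (pverts G) = p + q" "card U + card V \<le> p + q"
        by (rule cospectral_complete_bipartite_imp_biclique[OF assms
              G[THEN conjunct1] G[THEN conjunct2]])
      \<comment> \<open>Minimality gives one inequality, the number of vertices of \<open>G\<close>
        the other.\<close>
      have "card U + card V = p + q" using UV min by (meson le_antisym)
      then consider "card U = p" "card V = q" | "card U = q" "card V = p"
        using sum_prod_eq_imp UV(2) by blast
      then show "digraph_iso (with_proj G) (with_proj ?K)"
      proof cases
        case 1
        then show ?thesis
          by (intro digraph_iso_biclique[OF UV(1) K])
            (use UV in \<open>simp_all add: card_image card_pverts_complete_bipartite\<close>)
      next
        case 2
        then show ?thesis
          by (intro digraph_iso_biclique[OF biclique_commute[THEN iffD1, OF UV(1)] K])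
            (use UV in \<open>simp_all add: card_image card_pverts_complete_bipartite\<close>)
      qed
    qed
  qed
qed

end
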